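(* Let $n\ge1$ and $r\ge2$. The number $N_{n,r}^B$ of ordered $r$-tuples $(\pi_1,\pi_2,\ldots,\pi_r)$ of $B_n$-partitions that intersect minimally equals \[ N_{n,r}^B=\frac{2^n}{e^{r/2}}\sum_{l_1,l_2,\ldots,l_r\ge0}\frac{(f_r)_n}{(2l_1)!!\,(2l_2)!!\cdots(2l_r)!!},\qquad f_r=\frac12\left(\prod_{t=1}^{r}(2l_t+1)-1\right). \]
   Context: Let $[\pm n]=\{\pm1,\ldots,\pm n\}$. A $B_n$-partition is a partition of $[\pm n]$ into blocks such that (i) for every block $B$, $-B=\{-b:b\in B\}$ is also a block, and (ii) there is at most one block $B$ with $B=-B$ (the zero-block). The meet $\pi_1\wedge\cdots\wedge\pi_r$ (in the refinement order) is the partition whose blocks are the nonempty intersections $B_1\cap\cdots\cap B_r$ with $B_t$ a block of $\pi_t$; $\hat0^B=\{\{1\},\{-1\},\ldots,\{n\},\{-n\}\}$. The partitions $\pi_1,\ldots,\pi_r$ intersect minimally if $\pi_1\wedge\cdots\wedge\pi_r=\hat0^B$. $(x)_n=x(x-1)\cdots(x-n+1)$ is the falling factorial; $(2m)!!=2^m m!$, $0!!=1$. *)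

theory Defs
  imports "HOL-Analysis.Analysis" "HOL-Library.Disjoint_Sets"
begin

definition pm_set :: "nat \<Rightarrow> int set" where
  "pm_set n = {k. 1 \<le> \<bar>k\<bar> \<and> \<bar>k\<bar> \<le> int n}"

definition zero_block :: "int set set \<Rightarrow> int set \<Rightarrow> bool" where
  "zero_block \<pi> B \<longleftrightarrow> B \<in> \<pi> \<and> B = uminus ` B"

definition B_partition :: "nat \<Rightarrow> int set set \<Rightarrow> bool" where
  "B_partition n \<pi> \<longleftrightarrow>
     partition_on (pm_set n) \<pi> \<and>
     (\<forall>B\<in>\<pi>. uminus ` B \<in> \<pi>) \<and>
     (\<forall>B C. zero_block \<pi> B \<longrightarrow> zero_block \<pi> C \<longrightarrow> B = C)"

text \<open>The tuples \<open>(\<pi>\<^sub>1, \<dots>, \<pi>\<^sub>r)\<close> are extensional functions on \<open>{1..r}\<close>.  A block of the meet is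
  determined by a choice \<open>B\<close> of one block in each entry; the choice is indexed by position, so
  entries may repeat.\<close>

definition meet_tuple :: "nat \<Rightarrow> (nat \<Rightarrow> int set set) \<Rightarrow> int set set" where
  "meet_tuple r \<pi> = {(\<Inter>t\<in>{1..r}. B t) | B. \<forall>t\<in>{1..r}. B t \<in> \<pi> t} - {{}}"

definition B_zero :: "nat \<Rightarrow> int set set" where
  "B_zero n = (\<lambda>k. {k}) ` pm_set n"

definition intersect_minimally :: "nat \<Rightarrow> nat \<Rightarrow> (nat \<Rightarrow> int set set) \<Rightarrow> bool" where
  "intersect_minimally n r \<pi> \<longleftrightarrow> meet_tuple r \<pi> = B_zero n"

definition N_B :: "nat \<Rightarrow> nat \<Rightarrow> nat" where
  "N_B n r = card {\<pi> \<in> {1..r} \<rightarrow>\<^sub>E {\<rho>. B_partition n \<rho>}. intersect_minimally n r \<pi>}"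

definition falling_fact :: "real \<Rightarrow> nat \<Rightarrow> real" where
  "falling_fact x n = (\<Prod>i<n. x - real i)"

text \<open>\<open>even_double_fact m\<close> is \<open>(2m)!!\<close>, not \<open>m!!\<close>.\<close>

definition even_double_fact :: "nat \<Rightarrow> nat" where
  "even_double_fact m = 2 ^ m * fact m"

definition f_B :: "nat \<Rightarrow> (nat \<Rightarrow> nat) \<Rightarrow> real" where
  "f_B r l = ((\<Prod>t=1..r. 2 * real (l t) + 1) - 1) / 2"

end

theory Submission
  imports Defs
begin

text \<open>
  Represent a \<open>B\<^sub>n\<close>-partition by the fibres of odd maps \<open>g : [\<plusminus>n] \<rightarrow> {-l..l}\<close>, the zero-block being the
  fibre over \<open>0\<close>.  If it has \<open>m\<close> pairs of nonzero blocks, it arises from exactly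
  \<open>2l (2l - 2) \<cdots> (2l - 2m + 2)\<close> such maps, and dividing by \<open>(2l)!!\<close> and summing over \<open>l\<close> gives
  \<open>\<Sum>\<^sub>j 1 / (2j)!! = e\<^bsup>1/2\<^esup>\<close>, whatever \<open>m\<close> is.  On the other hand, the fibres of \<open>g\<^sub>1, \<dots>, g\<^sub>r\<close> intersect
  minimally iff \<open>(g\<^sub>1, \<dots>, g\<^sub>r)\<close> is an injective odd map into \<open>\<Prod>\<^sub>t {-l\<^sub>t..l\<^sub>t}\<close>, and there are
  \<open>2\<^sup>n (f\<^sub>r)\<^sub>n\<close> of those, since the images of \<open>1, \<dots>, n\<close> can be chosen one after the other.
\<close>

subsection \<open>Sums over product sets\<close>

text \<open>Induction on \<open>I\<close>: a choice function on \<open>insert i I\<close> is a pair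
  of a value at \<open>i\<close> and a choice function on \<open>I\<close>, so the sum becomes an
  iterated one that factors. Nonnegativity supplies the summability over pairs that lets the
  iterated sum be read as one sum.\<close>

lemma has_sum_prod_PiE:
  fixes f :: "'a \<Rightarrow> 'b \<Rightarrow> real"
  assumes "finite I" "\<And>i. i \<in> I \<Longrightarrow> (f i has_sum s i) (B i)"
    and "\<And>i x. i \<in> I \<Longrightarrow> x \<in> B i \<Longrightarrow> f i x \<ge> 0"
  shows "((\<lambda>g. \<Prod>i\<in>I. f i (g i)) has_sum (\<Prod>i\<in>I. s i)) (PiE I B)"
  using assms
proof (induction I)
  case empty
  then show ?case by (auto intro!: has_sum_finiteI)
next
  case (insert i I)
  let ?P = "\<lambda>g. \<Prod>i\<in>I. f i (g i)" and ?h = "\<lambda>(y, g). g(i := y)"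
  have eq: "(\<Prod>j\<in>insert i I. f j (?h p j)) = f i (fst p) * ?P (snd p)" for p
    using insert.hyps by (auto simp: case_prod_unfold intro!: prod.cong)
  have IH: "(?P has_sum prod s I) (PiE I B)"
    by (rule insert.IH) (use insert.prems in auto)
  have inner: "((\<lambda>g. f i (fst (y, g)) * ?P (snd (y, g))) has_sum f i y * prod s I) (PiE I B)" for y
    using has_sum_cmult_right[OF IH] by simp
  have outer: "((\<lambda>y. f i y * prod s I) has_sum s i * prod s I) (B i)"
    using insert.prems by (intro has_sum_cmult_left) auto
  have "((\<lambda>p. f i (fst p) * ?P (snd p)) has_sum s i * prod s I) (B i \<times> PiE I B)"
    using inner outer
    by (intro has_sum_SigmaI summable_on_SigmaI)
       (use insert.prems in \<open>auto intro!: mult_nonneg_nonneg prod_nonneg simp: PiE_iff dest: has_sum_imp_summable\<close>)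
  then have "((\<lambda>p. \<Prod>j\<in>insert i I. f j (?h p j)) has_sum prod s (insert i I)) (B i \<times> PiE I B)"
    unfolding eq using insert.hyps by simp
  then show ?case
    unfolding PiE_insert_eq
    by (subst has_sum_reindex) (use inj_combinator[OF insert.hyps(2)] in \<open>auto simp: o_def\<close>)
qed

lemma has_sum_sum:
  fixes f :: "'a \<Rightarrow> 'b \<Rightarrow> 'c::topological_comm_monoid_add"
  assumes "\<And>i. i \<in> I \<Longrightarrow> (f i has_sum s i) A"
  shows "((\<lambda>x. \<Sum>i\<in>I. f i x) has_sum (\<Sum>i\<in>I. s i)) A"
  using assms by (induction I rule: infinite_finite_induct) (auto intro: has_sum_add)

section \<open>A series with sum \<open>exp (1/2)\<close> for every \<open>m\<close>\<close>

lemma prod_even_eq_0: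
  fixes l m :: nat
  assumes "l < m"
  shows "(\<Prod>i<m. 2 * real l - 2 * real i) = 0"
  using assms by (intro prod_zero) auto

lemma prod_even_eq_fact:
  "(\<Prod>i<m. 2 * real (k + m) - 2 * real i) * real (even_double_fact k)
     = real (even_double_fact (k + m))"
proof (induction m arbitrary: k)
  case (Suc m)
  \<comment> \<open>The last factor, at \<open>i = m\<close>, is 2(k + 1). It turns (2k)!! into (2k
    + 2)!!, hence the induction hypothesis at \<open>Suc k\<close>.\<close>
  have "(\<Prod>i<Suc m. 2 * real (k + Suc m) - 2 * real i)
          = (\<Prod>i<m. 2 * real (Suc k + m) - 2 * real i) * (2 * real (Suc k))"
    by simp
  then show ?case
    using Suc.IH[of "Suc k"] by (simp add: even_double_fact_def algebra_simps)
qed (simp add: even_double_fact_def)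

text \<open>For l < m the factor with i = l vanishes. For l = k + m the product is (2l)!!/(2k)!!, so
  the term is 1/(2k)!! = (1/2)^k/k!, and the exponential series at 1/2 remains.\<close>

lemma has_sum_prod_even_div_double_fact:
  "((\<lambda>l. (\<Prod>i<m. 2 * real l - 2 * real i) / real (even_double_fact l)) has_sum exp (1/2)) UNIV"
proof -
  let ?F = "\<lambda>l. (\<Prod>i<m. 2 * real l - 2 * real i) / real (even_double_fact l)"
  have pos: "even_double_fact k > 0" for k
    by (simp add: even_double_fact_def)
  have shift: "?F (k + m) = (1/2) ^ k /\<^sub>R fact k" for k
  proof -
    have "?F (k + m) = 1 / real (even_double_fact k)"
      using prod_even_eq_fact[of k m] pos[of k] pos[of "k+m"]
      by (simp add: field_simps)
    then show ?thesis
      by (simp add: even_double_fact_def field_simps power_divide)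
  qed
  have "((\<lambda>k. ?F (k + m)) has_sum exp (1/2)) UNIV"
    unfolding shift by (intro sums_nonneg_imp_has_sum exp_converges) auto
  then have "(?F has_sum exp (1/2)) (range (\<lambda>k. k + m))"
    by (subst has_sum_reindex) (auto simp: o_def)
  moreover have "(?F has_sum S) (range (\<lambda>k. k + m)) \<longleftrightarrow> (?F has_sum S) UNIV" for S
  proof (rule has_sum_cong_neutral)
    fix l assume "l \<in> UNIV - range (\<lambda>k. k + m)"
    then have "l < m" by (metis DiffD2 le_add_diff_inverse2 not_le rangeI)
    then show "?F l = 0" by (simp add: prod_even_eq_0)
  qed auto
  ultimately show ?thesis by simp
qed

subsection \<open>Injective equivariant maps\<close>

text \<open>Serves two counts: labellings of the nonzero blocks of one partition by nonzero
  integers, and maps from the signed points into a box without its origin.\<close>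

definition equi_inj :: "'a set \<Rightarrow> ('a \<Rightarrow> 'a) \<Rightarrow> 'b set \<Rightarrow> ('b \<Rightarrow> 'b) \<Rightarrow> ('a \<Rightarrow> 'b) set" where
  "equi_inj A \<tau> Y \<sigma> = {\<phi> \<in> A \<rightarrow>\<^sub>E Y. inj_on \<phi> A \<and> (\<forall>a\<in>A. \<phi> (\<tau> a) = \<sigma> (\<phi> a))}"

definition free_involution_on :: "'a set \<Rightarrow> ('a \<Rightarrow> 'a) \<Rightarrow> bool" where
  "free_involution_on A \<tau> \<longleftrightarrow> (\<forall>a\<in>A. \<tau> a \<in> A \<and> \<tau> a \<noteq> a \<and> \<tau> (\<tau> a) = a)"

lemma finite_equi_inj: "finite A \<Longrightarrow> finite Y \<Longrightarrow> finite (equi_inj A \<tau> Y \<sigma>)"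
  unfolding equi_inj_def by (rule finite_subset[of _ "A \<rightarrow>\<^sub>E Y"]) (auto intro: finite_PiE)

text \<open>A map on \<open>A'\<close> extends over the orbit of \<open>a\<close> by choosing the
  image of \<open>a\<close> outside the image of \<open>A'\<close>; equivariance then dictates the
  image of \<open>\<tau> a\<close>. The number of choices does not depend on the map extended. Over
  the reals the formula survives \<open>card Y < card A'\<close>, where no map on \<open>A'\<close>
  exists.\<close>

lemma card_equi_inj_extend:
  assumes A: "finite A" "free_involution_on A \<tau>" and Y: "finite Y" "free_involution_on Y \<sigma>"
    and a: "a \<in> A" and A': "A' = A - {a, \<tau> a}"
  shows "real (card (equi_inj A \<tau> Y \<sigma>))
           = real (card (equi_inj A' \<tau> Y \<sigma>)) * (real (card Y) - real (card A'))"
proof -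
  have ta: "\<tau> a \<in> A" "\<tau> a \<noteq> a" "\<tau> (\<tau> a) = a"
    using A a by (auto simp: free_involution_on_def)
  have tA': "\<tau> b \<in> A'" if "b \<in> A'" for b
    using that A(2) a unfolding A' free_involution_on_def by (metis DiffE DiffI insert_iff singletonD)
  have AA': "A = insert a (insert (\<tau> a) A')" "a \<notin> A'" "\<tau> a \<notin> A'"
    using a ta by (auto simp: A')
  have sY: "\<sigma> y \<in> Y" "\<sigma> y \<noteq> y" "\<sigma> (\<sigma> y) = y" if "y \<in> Y" for y
    using Y(2) that by (auto simp: free_involution_on_def)
  let ?E = "equi_inj A \<tau> Y \<sigma>" and ?E' = "equi_inj A' \<tau> Y \<sigma>"
  let ?S = "Sigma ?E' (\<lambda>\<phi>. Y - \<phi> ` A')"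
  let ?h = "\<lambda>(\<phi>, y). \<phi>(a := y, \<tau> a := \<sigma> y)"
  have "bij_betw ?h ?S ?E"
  proof (rule bij_betwI')
    fix p q assume p: "p \<in> ?S" and q: "q \<in> ?S"
    obtain \<phi> y \<psi> z where pq: "p = (\<phi>, y)" "q = (\<psi>, z)" by (metis surj_pair)
    show "?h p = ?h q \<longleftrightarrow> p = q"
    proof
      assume eq: "?h p = ?h q"
      have "y = z" using fun_cong[OF eq, of a] ta by (simp add: pq)
      moreover have "\<phi> x = \<psi> x" for x
      proof (cases "x \<in> A'")
        case True
        then have "x \<noteq> a" "x \<noteq> \<tau> a" using AA'(2,3) by auto
        then show ?thesis using fun_cong[OF eq, of x] by (simp add: pq)
      next
        case False
        then show ?thesis using p q
          by (auto simp: pq equi_inj_def PiE_def extensional_def)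
      qed
      ultimately show "p = q" by (auto simp: pq)
    qed auto
  next
    fix p assume p: "p \<in> ?S"
    obtain \<phi> y where pq: "p = (\<phi>, y)" by (metis surj_pair)
    have \<phi>: "\<phi> \<in> A' \<rightarrow>\<^sub>E Y" "inj_on \<phi> A'" "\<And>b. b \<in> A' \<Longrightarrow> \<phi> (\<tau> b) = \<sigma> (\<phi> b)"
      and y: "y \<in> Y" "y \<notin> \<phi> ` A'"
      using p by (auto simp: pq equi_inj_def)
    \<comment> \<open>The image of \<open>A'\<close> is stable under \<open>\<sigma>\<close>, so
      avoiding it with \<open>y\<close> already avoids it with \<open>\<sigma> y\<close>.\<close>
    have y': "\<sigma> y \<notin> \<phi> ` A'"
    proof
      assume "\<sigma> y \<in> \<phi> ` A'"
      then obtain b where b: "b \<in> A'" "\<sigma> y = \<phi> b" by auto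
      then have "y = \<phi> (\<tau> b)" using \<phi>(3) sY(3)[OF y(1)] by metis
      then show False using y(2) tA'[OF b(1)] by blast
    qed
    let ?g = "\<phi>(a := y, \<tau> a := \<sigma> y)"
    have g': "?g b = \<phi> b" if "b \<in> A'" for b using that AA' by auto
    have "?g \<in> A \<rightarrow>\<^sub>E Y"
    proof -
      have "?g \<in> insert (\<tau> a) (insert a A') \<rightarrow>\<^sub>E Y"
        using \<phi>(1) y(1) sY(1) by (intro PiE_fun_upd) auto
      then show ?thesis by (simp add: AA'(1) insert_commute)
    qed
    moreover have "inj_on ?g A"
    proof -
      have "inj_on ?g A'" using \<phi>(2) g' by (simp add: inj_on_def)
      moreover have "?g ` A' = \<phi> ` A'" using g' by auto
      ultimately show ?thesis
        using y y' sY(2)[OF y(1)] ta(2) AA'(2,3) by (auto simp: AA'(1))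
    qed
    moreover have "?g (\<tau> b) = \<sigma> (?g b)" if b: "b \<in> A" for b
    proof -
      consider "b = a" | "b = \<tau> a" | "b \<in> A'" using b unfolding AA'(1) by blast
      then show ?thesis
      proof cases
        case 3
        then show ?thesis using g'[OF 3] g'[OF tA'[OF 3]] \<phi>(3) by simp
      qed (use ta sY(3)[OF y(1)] in auto)
    qed
    ultimately show "?h p \<in> ?E" by (simp add: pq equi_inj_def)
  next
    fix g assume g: "g \<in> ?E"
    then have g1: "g \<in> A \<rightarrow>\<^sub>E Y" "inj_on g A" "\<And>b. b \<in> A \<Longrightarrow> g (\<tau> b) = \<sigma> (g b)"
      by (auto simp: equi_inj_def)
    have "restrict g A' \<in> ?E'"
      using g1 tA' by (auto simp: equi_inj_def inj_on_def A')
    moreover have "g a \<notin> restrict g A' ` A'"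
      using g1(2) a by (auto simp: inj_on_def A')
    moreover have "g a \<in> Y" using g1(1) a by auto
    moreover have "g = ?h (restrict g A', g a)"
      using g1(1,3) a AA' by (auto simp: fun_eq_iff PiE_def extensional_def)
    ultimately show "\<exists>p\<in>?S. g = ?h p" by blast
  qed
  then have "card ?E = card ?S"
    using bij_betw_same_card by fastforce
  also have "\<dots> = (\<Sum>\<phi>\<in>?E'. card (Y - \<phi> ` A'))"
    using A(1) Y(1)
    by (intro card_SigmaI finite_equi_inj) (auto simp: A')
  finally have "real (card ?E) = (\<Sum>\<phi>\<in>?E'. real (card (Y - \<phi> ` A')))" by simp
  also have "\<dots> = (\<Sum>\<phi>\<in>?E'. real (card Y) - real (card A'))"
  proof (rule sum.cong)
    fix \<phi> assume "\<phi> \<in> ?E'"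
    then have sub: "\<phi> ` A' \<subseteq> Y" and "inj_on \<phi> A'" by (auto simp: equi_inj_def)
    then have "card (\<phi> ` A') = card A'" by (simp add: card_image)
    then show "real (card (Y - \<phi> ` A')) = real (card Y) - real (card A')"
      using sub Y(1) by (metis card_Diff_subset card_mono finite_subset of_nat_diff)
  qed simp
  finally show ?thesis by simp
qed

text \<open>Orbits of \<open>\<tau>\<close> are removed one at a time. Parity is carried through the
  induction because the index of each new factor is half the number of points left.\<close>

lemma card_equi_inj:
  assumes A: "finite A" "free_involution_on A \<tau>" and Y: "finite Y" "free_involution_on Y \<sigma>"
  shows "even (card A) \<and>
    real (card (equi_inj A \<tau> Y \<sigma>)) = (\<Prod>i<card A div 2. real (card Y) - 2 * real i)"
  using A
proof (induction A rule: finite_psubset_induct)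
  case (psubset A)
  show ?case
  proof (cases "A = {}")
    case True
    then show ?thesis by (simp add: equi_inj_def)
  next
    case False
    then obtain a where a: "a \<in> A" by blast
    define A' where "A' = A - {a, \<tau> a}"
    have ta: "\<tau> a \<in> A" "\<tau> a \<noteq> a"
      using psubset.prems a by (auto simp: free_involution_on_def)
    have "free_involution_on A' \<tau>"
      using psubset.prems a unfolding A'_def free_involution_on_def by (metis DiffE DiffI insert_iff singletonD)
    moreover have "A' \<subset> A" using a by (auto simp: A'_def)
    ultimately have IH: "even (card A')"
      "real (card (equi_inj A' \<tau> Y \<sigma>)) = (\<Prod>i<card A' div 2. real (card Y) - 2 * real i)"
      using psubset.IH by auto
    have "card A = card (insert a (insert (\<tau> a) A'))"
      using a ta by (intro arg_cong[where f = card]) (auto simp: A'_def)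
    also have "\<dots> = card A' + 2"
      using psubset.hyps ta by (simp add: A'_def)
    finally have card: "card A = card A' + 2" .
    \<comment> \<open>By parity the factor \<open>card Y - card A'\<close> is the one with
      \<open>i = card A' div 2\<close>, the last index of the product for \<open>A\<close>.\<close>
    have "real (card A') = 2 * real (card A' div 2)"
      using IH(1) by (simp add: real_of_nat_div)
    then show ?thesis
      using card_equi_inj_extend[OF psubset.hyps psubset.prems Y a A'_def] IH card by simp
  qed
qed

subsection \<open>Fibres\<close>

text \<open>Indexed by the points of \<open>A\<close> rather than by values, so that no empty fibre
  appears as a block.\<close>

definition fibres :: "'a set \<Rightarrow> ('a \<Rightarrow> 'b) \<Rightarrow> 'a set set" where
  "fibres A g = (\<lambda>x. {y\<in>A. g y = g x}) ` A"

lemma partition_on_fibres: "partition_on A (fibres A g)"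
  by (rule partition_onI) (auto simp: fibres_def disjnt_def)

lemma fibres_eq_iff:
  "fibres A g = fibres A h \<longleftrightarrow> (\<forall>x\<in>A. \<forall>y\<in>A. g x = g y \<longleftrightarrow> h x = h y)"
proof
  assume eq: "fibres A g = fibres A h"
  have *: "{y\<in>A. g y = g x} = {y\<in>A. h y = h x}" if "x \<in> A" for x
  proof -
    have "{y\<in>A. g y = g x} \<in> fibres A g" using that by (auto simp: fibres_def)
    then have "{y\<in>A. g y = g x} \<in> fibres A h" unfolding eq .
    then obtain z where z: "{y\<in>A. g y = g x} = {y\<in>A. h y = h z}" by (auto simp: fibres_def)
    moreover have "x \<in> {y\<in>A. g y = g x}" using that by simp
    ultimately have "h x = h z" by simp
    then show ?thesis using z by simp
  qed
  show "\<forall>x\<in>A. \<forall>y\<in>A. g x = g y \<longleftrightarrow> h x = h y" using * by blast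
next
  assume "\<forall>x\<in>A. \<forall>y\<in>A. g x = g y \<longleftrightarrow> h x = h y"
  then show "fibres A g = fibres A h"
    unfolding fibres_def by (intro image_cong) auto
qed

text \<open>If blocks of the r partitions share a point x, each is the fibre through x, so their
  intersection is the fibre through x of the joint map.\<close>

lemma meet_tuple_fibres:
  assumes "r \<ge> 1" "\<And>t. t \<in> {1..r} \<Longrightarrow> \<pi> t = fibres A (g t)"
  shows "meet_tuple r \<pi> = fibres A (\<lambda>x. \<lambda>t\<in>{1..r}. g t x)" (is "_ = fibres A ?G")
proof (intro equalityI subsetI)
  have G: "?G y = ?G x \<longleftrightarrow> (\<forall>t\<in>{1..r}. g t y = g t x)" for x y
    by (auto simp: fun_eq_iff restrict_def)
  {
    fix C assume "C \<in> meet_tuple r \<pi>"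
    then obtain B where B: "C = (\<Inter>t\<in>{1..r}. B t)" "\<And>t. t \<in> {1..r} \<Longrightarrow> B t \<in> fibres A (g t)" "C \<noteq> {}"
      using assms(2) unfolding meet_tuple_def by blast
    then obtain x where x: "x \<in> C" by blast
    have Bt: "B t = {y\<in>A. g t y = g t x}" if "t \<in> {1..r}" for t
      using B(2)[OF that] x that unfolding B(1) fibres_def by fastforce
    \<comment> \<open>At least one index is needed to keep the intersection inside \<open>A\<close>;
      an empty one would be all of the type.\<close>
    have "1 \<in> {1..r}" using assms(1) by simp
    then have "x \<in> A" using Bt x B(1) by auto
    moreover have "C = {y\<in>A. ?G y = ?G x}"
      unfolding G B(1) using Bt \<open>1 \<in> {1..r}\<close> by auto
    ultimately show "C \<in> fibres A ?G" unfolding fibres_def by blast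
  }
  {
    fix C assume "C \<in> fibres A ?G"
    then obtain x where x: "x \<in> A" "C = {y\<in>A. ?G y = ?G x}" by (auto simp: fibres_def)
    have "C = (\<Inter>t\<in>{1..r}. {y\<in>A. g t y = g t x})"
      unfolding x(2) G using assms(1) by auto
    moreover have "\<forall>t\<in>{1..r}. {y\<in>A. g t y = g t x} \<in> \<pi> t"
      using assms(2) x(1) by (auto simp: fibres_def)
    moreover have "x \<in> C" using x by simp
    ultimately show "C \<in> meet_tuple r \<pi>" unfolding meet_tuple_def by blast
  }
qed

lemma intersect_minimally_fibres:
  assumes "r \<ge> 1" "\<And>t. t \<in> {1..r} \<Longrightarrow> \<pi> t = fibres (pm_set n) (g t)"
  shows "intersect_minimally n r \<pi> \<longleftrightarrow> inj_on (\<lambda>x. \<lambda>t\<in>{1..r}. g t x) (pm_set n)"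
proof -
  \<comment> \<open>With the singletons written as fibres of the identity, equality of partitions
    compares equivalence relations and becomes injectivity.\<close>
  have zero: "B_zero n = fibres (pm_set n) id"
    by (auto simp: B_zero_def fibres_def intro!: image_cong)
  have meet: "meet_tuple r \<pi> = fibres (pm_set n) (\<lambda>x. \<lambda>t\<in>{1..r}. g t x)"
    by (rule meet_tuple_fibres) (use assms in auto)
  show ?thesis
    unfolding intersect_minimally_def meet zero fibres_eq_iff inj_on_def
    by auto
qed

subsection \<open>Odd maps\<close>

definition odd_maps :: "nat \<Rightarrow> nat \<Rightarrow> (int \<Rightarrow> int) set" where
  "odd_maps n l = {g \<in> pm_set n \<rightarrow>\<^sub>E {- int l..int l}. \<forall>x\<in>pm_set n. g (- x) = - g x}"

lemma finite_pm_set: "finite (pm_set n)"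
  by (rule finite_subset[of _ "{- int n..int n}"]) (auto simp: pm_set_def)

lemma card_pm_set: "card (pm_set n) = 2 * n"
proof -
  have "pm_set n = {- int n..int n} - {0}" by (auto simp: pm_set_def)
  then show ?thesis by (simp add: card_Diff_subset)
qed

lemma uminus_pm_set: "- x \<in> pm_set n \<longleftrightarrow> x \<in> pm_set n"
  by (simp add: pm_set_def)

lemma finite_odd_maps: "finite (odd_maps n l)"
  unfolding odd_maps_def
  by (rule finite_subset[of _ "pm_set n \<rightarrow>\<^sub>E {- int l..int l}"]) (auto intro: finite_PiE finite_pm_set)

text \<open>Negation carries the fibre over v to the fibre over -v. A fibre equal to its negative
  therefore has v = -v, so it can only be the fibre over 0.\<close>

lemma B_partition_fibres:
  assumes g: "g \<in> odd_maps n l"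
  shows "B_partition n (fibres (pm_set n) g)"
proof -
  let ?A = "pm_set n"
  have odd: "g (- x) = - g x" if "x \<in> ?A" for x
    using g that by (auto simp: odd_maps_def)
  have im: "uminus ` {y\<in>?A. g y = g x} = {y\<in>?A. g y = g (- x)}" if "x \<in> ?A" for x
  proof (intro equalityI subsetI)
    fix y assume "y \<in> {y\<in>?A. g y = g (- x)}"
    then have "- y \<in> {y\<in>?A. g y = g x}" using odd that by (auto simp: uminus_pm_set)
    then show "y \<in> uminus ` {y\<in>?A. g y = g x}" by (metis imageI minus_minus)
  qed (use odd that in \<open>auto simp: uminus_pm_set\<close>)
  have "uminus ` B \<in> fibres ?A g" if B: "B \<in> fibres ?A g" for B
  proof -
    obtain x where x: "x \<in> ?A" "B = {y\<in>?A. g y = g x}"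
      using B by (auto simp: fibres_def)
    then have "uminus ` B = {y\<in>?A. g y = g (- x)}" using im by simp
    moreover have "- x \<in> ?A" using x(1) by (simp add: uminus_pm_set)
    ultimately show ?thesis unfolding fibres_def by blast
  qed
  moreover have "B = {y\<in>?A. g y = 0}" if B: "zero_block (fibres ?A g) B" for B
  proof -
    obtain x where x: "x \<in> ?A" "B = {y\<in>?A. g y = g x}" "B = uminus ` B"
      using B unfolding zero_block_def fibres_def by blast
    have "x \<in> B" using x(1,2) by simp
    moreover have "B = {y\<in>?A. g y = g (- x)}" using x(3) im[OF x(1)] unfolding x(2) by (rule trans)
    ultimately have "x \<in> {y\<in>?A. g y = g (- x)}" by simp
    then have "g x = 0" using odd[OF x(1)] by simp
    then show ?thesis using x by simp
  qed
  ultimately show ?thesis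
    unfolding B_partition_def using partition_on_fibres[of ?A g] by auto
qed

section \<open>Odd maps with prescribed fibres\<close>

text \<open>Such a map amounts to an injective odd labelling of the nonzero blocks by nonzero
  values, and m is the number of pairs of opposite nonzero blocks. That m is chosen before l
  matters: the series over l is summed with m fixed.\<close>

lemma card_odd_maps_fibres:
  assumes "B_partition n \<pi>"
  shows "\<exists>m. \<forall>l. real (card {g \<in> odd_maps n l. fibres (pm_set n) g = \<pi>})
                   = (\<Prod>i<m. 2 * real l - 2 * real i)"
proof -
  let ?A = "pm_set n"
  have part: "partition_on ?A \<pi>" and neg: "\<And>B. B \<in> \<pi> \<Longrightarrow> uminus ` B \<in> \<pi>"
    and zero: "\<And>B C. zero_block \<pi> B \<Longrightarrow> zero_block \<pi> C \<Longrightarrow> B = C"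
    using assms by (auto simp: B_partition_def)
  define blk where "blk x = (SOME B. B \<in> \<pi> \<and> x \<in> B)" for x
  define rep where "rep B = (SOME x :: int. x \<in> B)" for B
  have blk: "blk x \<in> \<pi>" "x \<in> blk x" if "x \<in> ?A" for x
    using someI_ex[of "\<lambda>B. B \<in> \<pi> \<and> x \<in> B"] that partition_onD1[OF part]
    unfolding blk_def by auto
  have sub: "B \<subseteq> ?A" if "B \<in> \<pi>" for B
    using that partition_onD1[OF part] by auto
  have blk_eq: "blk x = B" if "B \<in> \<pi>" "x \<in> B" for x B
    using blk[of x] sub[OF that(1)] that partition_onD2[OF part]
    by (auto simp: disjoint_def)
  have rep: "rep B \<in> B" if "B \<in> \<pi>" for B
    using that partition_onD3[OF part] unfolding rep_def by (metis some_in_eq)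
  have repA: "rep B \<in> ?A" if "B \<in> \<pi>" for B
    using rep[OF that] sub[OF that] by auto
  have blk_rep: "blk (rep B) = B" if "B \<in> \<pi>" for B
    using rep that by (intro blk_eq)
  have blk_neg: "blk (- x) = uminus ` blk x" if "x \<in> ?A" for x
    using blk[OF that] neg by (intro blk_eq) auto
  have \<pi>: "\<pi> = fibres ?A blk"
  proof -
    have *: "{y\<in>?A. blk y = B} = B" if "B \<in> \<pi>" for B
      using blk blk_eq sub[OF that] that by blast
    have "fibres ?A blk = blk ` ?A"
      unfolding fibres_def by (intro image_cong) (use * blk in auto)
    also have "\<dots> = \<pi>" using blk(1) blk_rep repA by force
    finally show ?thesis by simp
  qed
  have fib: "fibres ?A g = \<pi> \<longleftrightarrow> (\<forall>x\<in>?A. \<forall>y\<in>?A. g x = g y \<longleftrightarrow> blk x = blk y)" for g :: "int \<Rightarrow> int"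
    unfolding \<pi> by (rule fibres_eq_iff)
  \<comment> \<open>The nonzero blocks. Negation acts on them without fixed points, and at most one
    block of \<open>\<pi>\<close> is left out.\<close>
  define Q where "Q = {B \<in> \<pi>. uminus ` B \<noteq> B}"
  have Q: "finite Q" "free_involution_on Q ((`) uminus)"
  proof -
    have "finite \<pi>" using part finite_pm_set by (rule finite_elements[rotated])
    then show "finite Q" by (simp add: Q_def)
    show "free_involution_on Q ((`) uminus)"
      using neg by (auto simp: free_involution_on_def Q_def image_image)
  qed
  have nonzero_or: "B = C" if "B \<in> \<pi> - Q" "C \<in> \<pi> - Q" for B C
    using zero[of B C] that by (auto simp: Q_def zero_block_def)
  have card: "real (card {g \<in> odd_maps n l. fibres ?A g = \<pi>})
      = (\<Prod>i<card Q div 2. 2 * real l - 2 * real i)" for l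
  proof -
    let ?Y = "{- int l..int l} - {0}" and ?S = "{g \<in> odd_maps n l. fibres ?A g = \<pi>}"
    let ?E = "equi_inj Q ((`) uminus) ?Y uminus"
    \<comment> \<open>A map is read off at block representatives; conversely a labelling is spread
      over the blocks, with the value 0 on the zero-block.\<close>
    let ?to = "\<lambda>g. \<lambda>B\<in>Q. g (rep B)"
    let ?from = "\<lambda>\<phi>. \<lambda>x\<in>?A. if blk x \<in> Q then \<phi> (blk x) else 0"
    have "bij_betw ?to ?S ?E"
    proof (rule bij_betw_byWitness[where f' = ?from])
      have S: "g \<in> ?A \<rightarrow>\<^sub>E {- int l..int l}" "\<And>x. x \<in> ?A \<Longrightarrow> g (- x) = - g x"
        "\<And>x y. x \<in> ?A \<Longrightarrow> y \<in> ?A \<Longrightarrow> g x = g y \<longleftrightarrow> blk x = blk y"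
        if "g \<in> ?S" for g
        using that by (auto simp: odd_maps_def fib)
      show "\<forall>g\<in>?S. ?from (?to g) = g"
      proof (intro ballI ext)
        fix g x assume g: "g \<in> ?S"
        show "?from (?to g) x = g x"
        proof (cases "x \<in> ?A")
          case x: True
          show ?thesis
          proof (cases "blk x \<in> Q")
            case True
            then show ?thesis
              using S(3)[OF g x repA[OF blk(1)[OF x]]] blk_rep[OF blk(1)[OF x]] x by simp
          next
            case False
            \<comment> \<open>On the zero-block x and -x share a fibre, so oddness forces g x = 0,
              which agrees with the default in \<open>?from\<close>.\<close>
            then have "blk (- x) = blk x" using blk_neg[OF x] blk[OF x] by (simp add: Q_def)
            then have "g (- x) = g x" using S(3)[OF g] x uminus_pm_set by blast
            then show ?thesis using S(2)[OF g x] x False by simp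
          qed
        qed (use S(1)[OF g] in \<open>auto simp: PiE_def extensional_def\<close>)
      qed
      show "?to ` ?S \<subseteq> ?E"
      proof
        fix \<phi> assume "\<phi> \<in> ?to ` ?S"
        then obtain g where g: "g \<in> ?S" "\<phi> = ?to g" by auto
        have equi: "g (rep (uminus ` B)) = - g (rep B)" if "B \<in> \<pi>" for B
        proof -
          have "blk (rep (uminus ` B)) = blk (- rep B)"
            using that neg[OF that] blk_rep blk_neg[OF repA] by simp
          then show ?thesis
            using S(2,3)[OF g(1)] repA that neg[OF that] uminus_pm_set by metis
        qed
        have "g (rep B) \<in> ?Y" if "B \<in> Q" for B
        proof -
          have B: "B \<in> \<pi>" "uminus ` B \<noteq> B" using that by (auto simp: Q_def)
          \<comment> \<open>The distinct blocks B and -B receive distinct but opposite values, so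
            neither value is 0.\<close>
          have "g (rep (uminus ` B)) \<noteq> g (rep B)"
            using S(3)[OF g(1) repA[OF neg[OF B(1)]] repA[OF B(1)]] blk_rep[OF B(1)] blk_rep[OF neg[OF B(1)]] B(2)
            by simp
          then show ?thesis using equi[OF B(1)] S(1)[OF g(1)] repA[OF B(1)] by (auto simp: PiE_iff)
        qed
        moreover have "inj_on \<phi> Q"
        proof (rule inj_onI)
          fix B C assume BC: "B \<in> Q" "C \<in> Q" "\<phi> B = \<phi> C"
          then have "B \<in> \<pi>" "C \<in> \<pi>" by (auto simp: Q_def)
          moreover have "g (rep B) = g (rep C)" using BC by (simp add: g(2))
          ultimately show "B = C"
            using S(3)[OF g(1) repA[of B] repA[of C]] blk_rep[of B] blk_rep[of C] by simp
        qed
        moreover have "\<phi> (uminus ` B) = - \<phi> B" if "B \<in> Q" for B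
          using that Q(2) equi[of B] by (auto simp: g(2) Q_def free_involution_on_def)
        ultimately show "\<phi> \<in> ?E" by (auto simp: equi_inj_def g(2))
      qed
      have E: "\<phi> \<in> Q \<rightarrow>\<^sub>E ?Y" "inj_on \<phi> Q" "\<And>B. B \<in> Q \<Longrightarrow> \<phi> (uminus ` B) = - \<phi> B"
        if "\<phi> \<in> ?E" for \<phi>
        using that by (auto simp: equi_inj_def)
      show "\<forall>\<phi>\<in>?E. ?to (?from \<phi>) = \<phi>"
      proof (intro ballI ext)
        fix \<phi> B assume \<phi>: "\<phi> \<in> ?E"
        show "?to (?from \<phi>) B = \<phi> B"
        proof (cases "B \<in> Q")
          case True
          then have "B \<in> \<pi>" by (simp add: Q_def)
          then show ?thesis using True repA blk_rep by simp
        qed (use E(1)[OF \<phi>] in \<open>auto simp: PiE_def extensional_def\<close>)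
      qed
      show "?from ` ?E \<subseteq> ?S"
      proof
        fix g assume "g \<in> ?from ` ?E"
        then obtain \<phi> where \<phi>: "\<phi> \<in> ?E" "g = ?from \<phi>" by auto
        have Y: "\<phi> B \<in> ?Y" if "B \<in> Q" for B using E(1)[OF \<phi>(1)] that by auto
        have "g (- x) = - g x" if "x \<in> ?A" for x
        proof (cases "blk x \<in> Q")
          case True
          then have "uminus ` blk x \<in> Q" using Q(2) by (simp add: free_involution_on_def)
          then show ?thesis
            using True that E(3)[OF \<phi>(1) True] by (simp add: \<phi>(2) uminus_pm_set blk_neg)
        next
          case False
          then have "uminus ` blk x = blk x" using blk[OF that] by (simp add: Q_def)
          then show ?thesis using False that by (simp add: \<phi>(2) uminus_pm_set blk_neg)
        qed
        \<comment> \<open>Three cases: two blocks in \<open>Q\<close> are separated by injectivity,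
          one in \<open>Q\<close> and one outside by nonzero against 0, and two outside coincide by
          \<open>nonzero_or\<close>.\<close>
        moreover have "g x = g y \<longleftrightarrow> blk x = blk y" if "x \<in> ?A" "y \<in> ?A" for x y
          using that Y[of "blk x"] Y[of "blk y"] inj_onD[OF E(2)[OF \<phi>(1)], of "blk x" "blk y"]
            nonzero_or[of "blk x" "blk y"] blk(1)[of x] blk(1)[of y]
          by (auto simp: \<phi>(2))
        moreover have "g \<in> ?A \<rightarrow>\<^sub>E {- int l..int l}"
          using Y by (auto simp: \<phi>(2))
        ultimately show "g \<in> ?S" by (simp add: odd_maps_def fib)
      qed
    qed
    then have "card ?S = card ?E" by (rule bij_betw_same_card)
    moreover have "free_involution_on ?Y uminus" by (auto simp: free_involution_on_def)
    moreover have "card ?Y = 2 * l" by (simp add: card_Diff_subset)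
    ultimately show ?thesis
      using card_equi_inj[OF Q, of ?Y uminus] by simp
  qed
  then show ?thesis by blast
qed

section \<open>Jointly injective tuples of odd maps\<close>

text \<open>Exchanging the arguments turns a tuple of odd maps into one odd map from the signed
  points to a box. Injectivity keeps it off the origin, and on the rest of the box negation is free,
  so \<open>card_equi_inj\<close> applies.\<close>

lemma card_jointly_injective:
  assumes "r \<ge> 1"
  shows "real (card {G \<in> Pi\<^sub>E {1..r} (\<lambda>t. odd_maps n (l t)).
                 inj_on (\<lambda>x. \<lambda>t\<in>{1..r}. G t x) (pm_set n)}) = 2 ^ n * falling_fact (f_B r l) n"
proof -
  let ?A = "pm_set n" and ?I = "{1..r}"
  let ?P = "Pi\<^sub>E ?I (\<lambda>t. {- int (l t)..int (l t)})" and ?z = "\<lambda>t\<in>?I. 0 :: int"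
  let ?Y = "?P - {?z}" and ?\<sigma> = "\<lambda>y. \<lambda>t\<in>?I. - y t :: int"
  let ?S = "{G \<in> Pi\<^sub>E ?I (\<lambda>t. odd_maps n (l t)). inj_on (\<lambda>x. \<lambda>t\<in>?I. G t x) ?A}"
  let ?E = "equi_inj ?A uminus ?Y ?\<sigma>"
  let ?to = "\<lambda>G. \<lambda>x\<in>?A. \<lambda>t\<in>?I. G t x" and ?from = "\<lambda>\<phi>. \<lambda>t\<in>?I. \<lambda>x\<in>?A. \<phi> x t"
  have A: "free_involution_on ?A uminus"
    by (auto simp: free_involution_on_def pm_set_def)
  have "bij_betw ?to ?S ?E"
  proof (rule bij_betw_byWitness[where f' = ?from])
    show "\<forall>G\<in>?S. ?from (?to G) = G"
    proof (intro ballI ext)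
      fix G t x assume "G \<in> ?S"
      then have "G \<in> Pi\<^sub>E ?I (\<lambda>t. ?A \<rightarrow>\<^sub>E {- int (l t)..int (l t)})"
        by (auto simp: odd_maps_def PiE_iff)
      then show "?from (?to G) t x = G t x"
        by (auto simp: PiE_iff extensional_def)
    qed
    show "\<forall>\<phi>\<in>?E. ?to (?from \<phi>) = \<phi>"
    proof (intro ballI ext)
      fix \<phi> x t assume "\<phi> \<in> ?E"
      then have "\<phi> \<in> ?A \<rightarrow>\<^sub>E ?P" by (auto simp: equi_inj_def PiE_iff)
      then show "?to (?from \<phi>) x t = \<phi> x t"
        by (auto simp: PiE_iff extensional_def)
    qed
    show "?to ` ?S \<subseteq> ?E"
    proof
      fix \<phi> assume "\<phi> \<in> ?to ` ?S"
      then obtain G where G: "G \<in> ?S" "\<phi> = ?to G" by auto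
      have val: "G t x \<in> {- int (l t)..int (l t)}" and odd: "G t (- x) = - G t x"
        if "t \<in> ?I" "x \<in> ?A" for t x
        using G(1) that by (auto simp: odd_maps_def PiE_iff)
      have equi: "\<phi> (- x) = ?\<sigma> (\<phi> x)" if "x \<in> ?A" for x
        using that odd by (auto simp: G(2) uminus_pm_set)
      have inj: "inj_on \<phi> ?A" using G(1) by (simp add: G(2) inj_on_def)
      \<comment> \<open>The origin is its own negative, so a point x sent there would share its
        image with -x.\<close>
      have "\<phi> x \<noteq> ?z" if "x \<in> ?A" for x
      proof
        assume "\<phi> x = ?z"
        then have "\<phi> (- x) = \<phi> x" using equi[OF that] by (auto simp: fun_eq_iff)
        then have "- x = x" using inj that uminus_pm_set by (auto dest: inj_onD)
        then show False using that by (simp add: pm_set_def)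
      qed
      moreover have "\<phi> \<in> ?A \<rightarrow>\<^sub>E ?P" using val by (auto simp: G(2))
      ultimately show "\<phi> \<in> ?E" using equi inj by (auto simp: equi_inj_def PiE_iff)
    qed
    show "?from ` ?E \<subseteq> ?S"
    proof
      fix G assume "G \<in> ?from ` ?E"
      then obtain \<phi> where \<phi>: "\<phi> \<in> ?E" "G = ?from \<phi>" by auto
      have P: "\<phi> x \<in> ?P" and equi: "\<phi> (- x) = ?\<sigma> (\<phi> x)" if "x \<in> ?A" for x
        using \<phi>(1) that by (auto simp: equi_inj_def PiE_iff)
      have eq: "(\<lambda>t\<in>?I. G t x) = \<phi> x" if "x \<in> ?A" for x
        using P[OF that] that by (auto simp: \<phi>(2) PiE_iff extensional_def)
      have "inj_on \<phi> ?A" using \<phi>(1) by (simp add: equi_inj_def)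
      then have "inj_on (\<lambda>x. \<lambda>t\<in>?I. G t x) ?A"
        using eq by (simp add: inj_on_def)
      moreover have "G t \<in> odd_maps n (l t)" if "t \<in> ?I" for t
        using that P equi by (auto simp: \<phi>(2) odd_maps_def PiE_iff uminus_pm_set)
      ultimately show "G \<in> ?S" by (auto simp: \<phi>(2))
    qed
  qed
  then have "card ?S = card ?E" by (rule bij_betw_same_card)
  moreover have Y: "finite ?Y" by (auto intro: finite_PiE)
  moreover have "free_involution_on ?Y ?\<sigma>"
    unfolding free_involution_on_def
  proof (intro ballI conjI)
    fix y assume y: "y \<in> ?Y"
    show "?\<sigma> (?\<sigma> y) = y"
      using y by (auto simp: PiE_iff extensional_def)
    have z: "\<exists>t\<in>?I. y t \<noteq> 0"
    proof (rule ccontr)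
      assume "\<not> ?thesis"
      then have "y = ?z" using y by (auto simp: PiE_iff extensional_def)
      then show False using y by simp
    qed
    then obtain t where t: "t \<in> ?I" "y t \<noteq> 0" by blast
    have ne: "?\<sigma> y t \<noteq> y t" "?\<sigma> y t \<noteq> ?z t" using t by simp_all
    show "?\<sigma> y \<noteq> y" using ne(1) by metis
    have nz: "?\<sigma> y \<noteq> ?z" using ne(2) by metis
    have "?\<sigma> y \<in> ?P" using y by (auto simp: PiE_iff)
    then show "?\<sigma> y \<in> ?Y" using nz by blast
  qed
  ultimately have "real (card ?S) = (\<Prod>i<n. real (card ?Y) - 2 * real i)"
    using card_equi_inj[OF finite_pm_set A, of ?Y ?\<sigma>] by (simp add: card_pm_set)
  \<comment> \<open>The box has the product of the 2l_t + 1 as its size; removing the origin gives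
    the -1 in f_r.\<close>
  moreover have "real (card ?Y) = 2 * f_B r l"
  proof -
    have "?z \<in> ?P" by auto
    then have "card ?P = Suc (card ?Y)"
      by (intro card.remove) (auto intro: finite_PiE)
    moreover have "real (card ?P) = (\<Prod>t=1..r. 2 * real (l t) + 1)"
      by (simp add: card_PiE ac_simps)
    ultimately show ?thesis by (simp add: f_B_def)
  qed
  ultimately have "real (card ?S) = (\<Prod>i<n. 2 * (f_B r l - real i))"
    by (simp only: right_diff_distrib)
  also have "\<dots> = 2 ^ n * falling_fact (f_B r l) n"
    unfolding prod.distrib by (simp add: falling_fact_def)
  finally show ?thesis .
qed

section \<open>Double counting and summation over \<open>l\<close>\<close>

theorem theorem2p6:
  fixes n r :: nat
  assumes "n \<ge> 1" and "r \<ge> 2"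
  shows "(\<lambda>l. falling_fact (f_B r l) n / (\<Prod>t=1..r. real (even_double_fact (l t))))
           summable_on ({1..r} \<rightarrow>\<^sub>E (UNIV :: nat set)) \<and>
         real (N_B n r) =
           2 ^ n / exp (real r / 2) *
           (\<Sum>\<^sub>\<infinity>l \<in> {1..r} \<rightarrow>\<^sub>E (UNIV :: nat set).
              falling_fact (f_B r l) n / (\<Prod>t=1..r. real (even_double_fact (l t))))"
proof -
  let ?I = "{1..r}" and ?A = "pm_set n"
  let ?M = "{\<pi> \<in> ?I \<rightarrow>\<^sub>E {\<rho>. B_partition n \<rho>}. intersect_minimally n r \<pi>}"
  let ?F = "\<lambda>l. falling_fact (f_B r l) n / (\<Prod>t=1..r. real (even_double_fact (l t)))"
  let ?c = "\<lambda>\<rho> l. real (card {g \<in> odd_maps n l. fibres ?A g = \<rho>})"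
  have "finite {\<rho>. B_partition n \<rho>}"
    by (rule finite_subset[OF _ finitely_many_partition_on[OF finite_pm_set]]) (auto simp: B_partition_def)
  then have finM: "finite ?M"
    by (intro finite_subset[of ?M "?I \<rightarrow>\<^sub>E {\<rho>. B_partition n \<rho>}"] finite_PiE) auto
  \<comment> \<open>For fixed l, the jointly injective tuples of odd maps are grouped by the tuple
    of partitions that their fibres form.\<close>
  have count: "2 ^ n * falling_fact (f_B r l) n = (\<Sum>\<pi>\<in>?M. \<Prod>t\<in>?I. ?c (\<pi> t) (l t))" for l
  proof -
    let ?S = "{G \<in> Pi\<^sub>E ?I (\<lambda>t. odd_maps n (l t)). inj_on (\<lambda>x. \<lambda>t\<in>?I. G t x) ?A}"
    let ?k = "\<lambda>G. \<lambda>t\<in>?I. fibres ?A (G t)"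
    have min: "intersect_minimally n r (?k G) \<longleftrightarrow> inj_on (\<lambda>x. \<lambda>t\<in>?I. G t x) ?A" for G :: "nat \<Rightarrow> int \<Rightarrow> int"
      by (rule intersect_minimally_fibres) (use assms in auto)
    have fin: "finite ?S"
      by (rule finite_subset[of _ "Pi\<^sub>E ?I (\<lambda>t. odd_maps n (l t))"]) (auto intro: finite_PiE finite_odd_maps)
    have "?k ` ?S \<subseteq> ?M"
      using min B_partition_fibres by (fastforce simp: PiE_iff)
    then have "(\<Sum>\<pi>\<in>?M. \<Sum>G\<in>{G. G \<in> ?S \<and> ?k G = \<pi>}. 1) = (\<Sum>G\<in>?S. 1 :: nat)"
      by (rule sum.group[OF fin finM])
    then have "card ?S = (\<Sum>\<pi>\<in>?M. card {G. G \<in> ?S \<and> ?k G = \<pi>})" by simp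
    also have "\<dots> = (\<Sum>\<pi>\<in>?M. \<Prod>t\<in>?I. card {g \<in> odd_maps n (l t). fibres ?A g = \<pi> t})"
    proof (rule sum.cong)
      fix \<pi> assume \<pi>: "\<pi> \<in> ?M"
      \<comment> \<open>Joint injectivity depends only on the fibres and holds automatically when
        these form a tuple in \<open>?M\<close>. Hence the class is a full product and its size
        factors over t.\<close>
      have "{G. G \<in> ?S \<and> ?k G = \<pi>} = Pi\<^sub>E ?I (\<lambda>t. {g \<in> odd_maps n (l t). fibres ?A g = \<pi> t})"
      proof (intro equalityI subsetI)
        fix G assume G: "G \<in> Pi\<^sub>E ?I (\<lambda>t. {g \<in> odd_maps n (l t). fibres ?A g = \<pi> t})"
        have "?k G = \<pi>"
        proof
          fix t show "?k G t = \<pi> t" using G \<pi> by (auto simp: PiE_iff extensional_def)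
        qed
        then show "G \<in> {G. G \<in> ?S \<and> ?k G = \<pi>}" using G \<pi> min[of G] by (auto simp: PiE_iff)
      qed (auto simp: PiE_iff)
      then show "card {G. G \<in> ?S \<and> ?k G = \<pi>} = (\<Prod>t\<in>?I. card {g \<in> odd_maps n (l t). fibres ?A g = \<pi> t})"
        by (simp add: card_PiE)
    qed simp
    finally show ?thesis
      using card_jointly_injective[of r n l] assms by simp
  qed
  \<comment> \<open>Each coordinate series sums to e^(1/2) whatever the partition is, so every
    minimally intersecting tuple contributes the same e^(r/2).\<close>
  have "((\<lambda>l. \<Prod>t\<in>?I. ?c (\<pi> t) (l t) / real (even_double_fact (l t))) has_sum (\<Prod>t\<in>?I. exp (1/2)))
          (?I \<rightarrow>\<^sub>E UNIV)" if "\<pi> \<in> ?M" for \<pi>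
  proof (rule has_sum_prod_PiE)
    fix t assume "t \<in> ?I"
    then have "B_partition n (\<pi> t)" using that by (auto simp: PiE_iff)
    then obtain m where "\<And>l. ?c (\<pi> t) l = (\<Prod>i<m. 2 * real l - 2 * real i)"
      using card_odd_maps_fibres by blast
    then show "((\<lambda>l. ?c (\<pi> t) l / real (even_double_fact l)) has_sum exp (1/2)) UNIV"
      using has_sum_prod_even_div_double_fact[of m] by simp
  qed auto
  then have "((\<lambda>l. \<Sum>\<pi>\<in>?M. \<Prod>t\<in>?I. ?c (\<pi> t) (l t) / real (even_double_fact (l t)))
      has_sum (\<Sum>\<pi>\<in>?M. \<Prod>t\<in>?I. exp (1/2))) (?I \<rightarrow>\<^sub>E UNIV)"
    by (rule has_sum_sum)
  moreover have "(\<Sum>\<pi>\<in>?M. \<Prod>t\<in>?I. ?c (\<pi> t) (l t) / real (even_double_fact (l t))) = 2 ^ n * ?F l" for l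
    by (simp add: prod_dividef count flip: sum_divide_distrib)
  moreover have "(\<Sum>\<pi>\<in>?M. \<Prod>t\<in>?I. exp (1/2 :: real)) = real (N_B n r) * exp (real r / 2)"
    by (simp add: N_B_def flip: exp_of_nat_mult)
  ultimately have "((\<lambda>l. 2 ^ n * ?F l) has_sum (real (N_B n r) * exp (real r / 2))) (?I \<rightarrow>\<^sub>E UNIV)"
    by simp
  \<comment> \<open>Cancelling 2^n leaves a \<open>has_sum\<close> fact, which yields both the
    summability and the value.\<close>
  then have "(?F has_sum (real (N_B n r) * exp (real r / 2) / 2 ^ n)) (?I \<rightarrow>\<^sub>E UNIV)"
    by (subst (asm) has_sum_cmult_right_iff) auto
  then show ?thesis
    by (simp add: has_sum_iff)
qed

end
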